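(* Let $D$ be a finite simple digraph. Then \[\Pi(D)=\{\rho(H) : H \text{ is an induced strongly connected subdigraph of } D\}.\]
   Context: A simple digraph has no loops and no multiple arcs. For a digraph $D$ on vertices $\{1,\dots,n\}$, its adjacency matrix $A(D)=(a_{ij})$ has $a_{ij}=1$ if $(i,j)$ is an arc and $0$ otherwise. For a real matrix $A\in\mathcal{M}_n(\mathbb{R})$, $\lambda\in\mathbb{R}$ is a complementarity eigenvalue if there is a nonzero $x\geq\mathbf{o}$ with $Ax\geq\lambda x$ and $\langle x,Ax-\lambda x\rangle=0$; the set of these is $\Pi(A)$. The complementarity spectrum of $D$ is $\Pi(D):=\Pi(A(D))$ (independent of vertex labelling). $\rho(H)$ is the spectral radius of $A(H)$. A single vertex is considered a strongly connected digraph (with $\rho=0$). *)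

theory Defs
  imports
    "Graph_Theory.Digraph_Component"
    "Jordan_Normal_Form.Spectral_Radius"
begin

definition complementarity_spectrum :: "real mat \<Rightarrow> real set" where
  "complementarity_spectrum A =
     {l. \<exists>x \<in> carrier_vec (dim_row A).
           x \<noteq> 0\<^sub>v (dim_row A) \<and> x \<ge> 0\<^sub>v (dim_row A) \<and>
           A *\<^sub>v x \<ge> l \<cdot>\<^sub>v x \<and>
           scalar_prod x (A *\<^sub>v x - l \<cdot>\<^sub>v x) = 0}"

text \<open>
  A labelling names the vertices \<open>0, \<dots>, n - 1\<close> (instead of \<open>1, \<dots>, n\<close>), matching the row
  and column indices of matrices.
\<close>

definition is_labelling :: "('a, 'b) pre_digraph \<Rightarrow> (nat \<Rightarrow> 'a) \<Rightarrow> bool" where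
  "is_labelling D f \<longleftrightarrow> bij_betw f {0..<card (verts D)} (verts D)"

definition labelled_adj_mat :: "('a, 'b) pre_digraph \<Rightarrow> (nat \<Rightarrow> 'a) \<Rightarrow> real mat" where
  "labelled_adj_mat D f =
     mat (card (verts D)) (card (verts D)) (\<lambda>(i, j). if f i \<rightarrow>\<^bsub>D\<^esub> f j then 1 else 0)"

text \<open>
  The labelling is chosen arbitrarily; the spectral notions defined from \<open>adj_mat\<close> do not depend
  on it, see the lemmas \<open>digraph_spectral_radius_labelling\<close> and
  \<open>digraph_complementarity_spectrum_labelling\<close>.
\<close>

definition adj_mat :: "('a, 'b) pre_digraph \<Rightarrow> real mat" where
  "adj_mat D = labelled_adj_mat D (SOME f. is_labelling D f)"

definition digraph_spectral_radius :: "('a, 'b) pre_digraph \<Rightarrow> real" where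
  "digraph_spectral_radius D = spectral_radius (map_mat complex_of_real (adj_mat D))"

definition digraph_complementarity_spectrum :: "('a, 'b) pre_digraph \<Rightarrow> real set" where
  "digraph_complementarity_spectrum D = complementarity_spectrum (adj_mat D)"

lemma ex_labelling:
  assumes "finite (verts D)"
  shows "\<exists>f. is_labelling D f"
  using ex_bij_betw_nat_finite[OF assms] unfolding is_labelling_def .

lemma labelled_adj_mat_relabel:
  assumes f: "is_labelling D f" and g: "is_labelling D g"
  obtains p where "bij_betw p {0..<card (verts D)} {0..<card (verts D)}"
    and "labelled_adj_mat D g =
      mat (card (verts D)) (card (verts D)) (\<lambda>(i, j). labelled_adj_mat D f $$ (p i, p j))"
proof -
  let ?I = "{0..<card (verts D)}"
  define p where "p = inv_into ?I f \<circ> g"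
  have p: "bij_betw p ?I ?I"
    using f g unfolding p_def is_labelling_def by (meson bij_betw_inv_into bij_betw_trans)
  have fp: "f (p i) = g i" if "i \<in> ?I" for i
    using f g that unfolding p_def is_labelling_def
    by (metis bij_betw_apply bij_betw_inv_into_right comp_apply)
  have pI: "p i < card (verts D)" if "i < card (verts D)" for i
    using bij_betw_apply[OF p, of i] that by simp
  have "labelled_adj_mat D g =
      mat (card (verts D)) (card (verts D)) (\<lambda>(i, j). labelled_adj_mat D f $$ (p i, p j))"
    by (rule eq_matI) (simp_all add: labelled_adj_mat_def fp pI)
  with p show ?thesis by (rule that)
qed

lemma reindex_mult_mat_vec:
  fixes A :: "'c :: comm_ring_1 mat"
  assumes p: "bij_betw p {0..<n} {0..<n}" and A: "A \<in> carrier_mat n n" and v: "v \<in> carrier_vec n"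
  shows "mat n n (\<lambda>(i, j). A $$ (p i, p j)) *\<^sub>v vec n (\<lambda>i. v $ p i) =
    vec n (\<lambda>i. (A *\<^sub>v v) $ p i)"
proof (rule eq_vecI)
  fix i assume i: "i < dim_vec (vec n (\<lambda>i. (A *\<^sub>v v) $ p i))"
  then have pi: "p i < n" using bij_betw_apply[OF p, of i] by simp
  have "(\<Sum>j = 0..<n. A $$ (p i, p j) * v $ p j) = (\<Sum>j = 0..<n. A $$ (p i, j) * v $ j)"
    by (rule sum.reindex_bij_betw[OF p])
  then show "(mat n n (\<lambda>(i, j). A $$ (p i, p j)) *\<^sub>v vec n (\<lambda>i. v $ p i)) $ i =
      vec n (\<lambda>i. (A *\<^sub>v v) $ p i) $ i"
    using i pi A v by (simp add: scalar_prod_def row_def)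
qed simp

lemma reindex_nonzero:
  assumes p: "bij_betw p {0..<n} {0..<n}" and v: "v \<in> carrier_vec n" "v \<noteq> 0\<^sub>v n"
  shows "vec n (\<lambda>i. v $ p i) \<noteq> 0\<^sub>v n"
proof
  assume z: "vec n (\<lambda>i. v $ p i) = 0\<^sub>v n"
  have "v $ k = 0" if k: "k < n" for k
  proof -
    obtain i where i: "i < n" "k = p i"
      using p k by (metis atLeastLessThan_iff bij_betw_iff_bijections le0)
    from arg_cong[OF z, of "\<lambda>w. w $ i"] i show ?thesis by simp
  qed
  with v show False by (auto intro: eq_vecI)
qed

lemma spectrum_reindex:
  fixes A :: "complex mat"
  assumes p: "bij_betw p {0..<n} {0..<n}" and A: "A \<in> carrier_mat n n"
  shows "spectrum A \<subseteq> spectrum (mat n n (\<lambda>(i, j). A $$ (p i, p j)))"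
proof
  fix l assume "l \<in> spectrum A"
  then obtain v where v: "v \<in> carrier_vec n" "v \<noteq> 0\<^sub>v n" "A *\<^sub>v v = l \<cdot>\<^sub>v v"
    using A by (auto simp: spectrum_def eigenvalue_def eigenvector_def)
  have pI: "p i < n" if "i < n" for i
    using bij_betw_apply[OF p, of i] that by simp
  have "mat n n (\<lambda>(i, j). A $$ (p i, p j)) *\<^sub>v vec n (\<lambda>i. v $ p i) = l \<cdot>\<^sub>v vec n (\<lambda>i. v $ p i)"
    unfolding reindex_mult_mat_vec[OF p A v(1)] v(3) using v(1) by (auto simp: pI)
  with reindex_nonzero[OF p v(1,2)]
  show "l \<in> spectrum (mat n n (\<lambda>(i, j). A $$ (p i, p j)))"
    unfolding spectrum_def eigenvalue_def eigenvector_def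
    by (auto intro!: exI[of _ "vec n (\<lambda>i. v $ p i)"])
qed

lemma complementarity_spectrum_reindex:
  assumes p: "bij_betw p {0..<n} {0..<n}" and A: "A \<in> carrier_mat n n"
  shows "complementarity_spectrum A \<subseteq>
    complementarity_spectrum (mat n n (\<lambda>(i, j). A $$ (p i, p j)))"
proof
  let ?B = "mat n n (\<lambda>(i, j). A $$ (p i, p j))"
  fix l assume "l \<in> complementarity_spectrum A"
  then obtain v where v: "v \<in> carrier_vec n" "v \<noteq> 0\<^sub>v n" and nn: "v \<ge> 0\<^sub>v n"
    and ge: "A *\<^sub>v v \<ge> l \<cdot>\<^sub>v v" and ortho: "scalar_prod v (A *\<^sub>v v - l \<cdot>\<^sub>v v) = 0"
    using A by (auto simp: complementarity_spectrum_def)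
  define w where "w = vec n (\<lambda>i. v $ p i)"
  have pI: "p i < n" if "i < n" for i
    using bij_betw_apply[OF p, of i] that by simp
  have Bw: "?B *\<^sub>v w = vec n (\<lambda>i. (A *\<^sub>v v) $ p i)"
    unfolding w_def by (rule reindex_mult_mat_vec[OF p A v(1)])
  have w: "w \<in> carrier_vec n" "w \<noteq> 0\<^sub>v n"
    using reindex_nonzero[OF p v] by (auto simp: w_def)
  have nn': "w \<ge> 0\<^sub>v n"
    using nn v(1) pI by (auto simp: less_eq_vec_def w_def)
  have ge': "?B *\<^sub>v w \<ge> l \<cdot>\<^sub>v w"
    unfolding Bw using ge v(1) A pI by (auto simp: less_eq_vec_def w_def)
  have "scalar_prod w (?B *\<^sub>v w - l \<cdot>\<^sub>v w) =
      (\<Sum>i = 0..<n. v $ p i * ((A *\<^sub>v v) $ p i - l * v $ p i))"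
    unfolding Bw using v(1) pI by (simp add: scalar_prod_def w_def)
  also have "\<dots> = (\<Sum>i = 0..<n. v $ i * ((A *\<^sub>v v) $ i - l * v $ i))"
    by (rule sum.reindex_bij_betw[OF p])
  also have "\<dots> = scalar_prod v (A *\<^sub>v v - l \<cdot>\<^sub>v v)"
    using v(1) A by (simp add: scalar_prod_def)
  finally have "scalar_prod w (?B *\<^sub>v w - l \<cdot>\<^sub>v w) = 0"
    using ortho by simp
  with w nn' ge' show "l \<in> complementarity_spectrum ?B"
    unfolding complementarity_spectrum_def by auto
qed

lemma labelled_adj_mat_carrier:
  "labelled_adj_mat D f \<in> carrier_mat (card (verts D)) (card (verts D))"
  by (simp add: labelled_adj_mat_def)

lemma complementarity_spectrum_labelled_le:
  assumes "is_labelling D f" "is_labelling D g"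
  shows "complementarity_spectrum (labelled_adj_mat D f) \<subseteq>
    complementarity_spectrum (labelled_adj_mat D g)"
proof -
  obtain p where p: "bij_betw p {0..<card (verts D)} {0..<card (verts D)}"
    and g: "labelled_adj_mat D g =
      mat (card (verts D)) (card (verts D)) (\<lambda>(i, j). labelled_adj_mat D f $$ (p i, p j))"
    using labelled_adj_mat_relabel[OF assms] .
  show ?thesis
    unfolding g by (rule complementarity_spectrum_reindex[OF p labelled_adj_mat_carrier])
qed

lemma spectrum_labelled_le:
  assumes "is_labelling D f" "is_labelling D g"
  shows "spectrum (map_mat complex_of_real (labelled_adj_mat D f)) \<subseteq>
    spectrum (map_mat complex_of_real (labelled_adj_mat D g))"
proof -
  let ?n = "card (verts D)"
  obtain p where p: "bij_betw p {0..<?n} {0..<?n}"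
    and g: "labelled_adj_mat D g = mat ?n ?n (\<lambda>(i, j). labelled_adj_mat D f $$ (p i, p j))"
    using labelled_adj_mat_relabel[OF assms] .
  have pI: "p i < ?n" if "i < ?n" for i
    using bij_betw_apply[OF p, of i] that by simp
  have "map_mat complex_of_real (labelled_adj_mat D g) =
      mat ?n ?n (\<lambda>(i, j). map_mat complex_of_real (labelled_adj_mat D f) $$ (p i, p j))"
    unfolding g by (rule eq_matI) (simp_all add: pI labelled_adj_mat_def)
  moreover have "map_mat complex_of_real (labelled_adj_mat D f) \<in> carrier_mat ?n ?n"
    by (simp add: labelled_adj_mat_def)
  ultimately show ?thesis
    using spectrum_reindex[OF p] by metis
qed

lemma digraph_complementarity_spectrum_labelling:
  assumes "is_labelling D f"
  shows "digraph_complementarity_spectrum D = complementarity_spectrum (labelled_adj_mat D f)"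
  unfolding digraph_complementarity_spectrum_def adj_mat_def
  using assms complementarity_spectrum_labelled_le someI[of "is_labelling D"] by blast

lemma digraph_spectral_radius_labelling:
  assumes "is_labelling D f"
  shows "digraph_spectral_radius D =
    spectral_radius (map_mat complex_of_real (labelled_adj_mat D f))"
proof -
  have "spectrum (map_mat complex_of_real (adj_mat D)) =
      spectrum (map_mat complex_of_real (labelled_adj_mat D f))"
    unfolding adj_mat_def
    using assms spectrum_labelled_le someI[of "is_labelling D"] by blast
  then show ?thesis
    by (simp add: digraph_spectral_radius_def spectral_radius_def)
qed

end

theory Submission
  imports Defs
begin

text \<open>
  On the support of a complementarity eigenvector \<open>x\<close>, complementary slackness gives
  \<open>A x = \<lambda> x\<close>. A strongly connected set of support vertices that no arc leaves within the support
  inherits this equation, and a positive eigenvector belongs to the spectral radius. Conversely,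
  a nonnegative eigenvector of a strongly connected induced subgraph for its spectral radius,
  extended by zero, is a complementarity eigenvector. To find one, take the entrywise modulus \<open>x\<close>
  of a complex eigenvector for an eigenvalue of maximal modulus, so that \<open>\<rho> x \<le> A x\<close>. If equality
  failed, strong connectivity would make \<open>y = (I + A)\<^sup>m x\<close> satisfy \<open>(\<rho> + \<epsilon>) y \<le> A y\<close> for some
  \<open>\<epsilon> > 0\<close>, contradicting the growth rate of the powers of \<open>A\<close>.
\<close>

section \<open>Subeigenvectors of nonnegative matrices\<close>

text \<open>
  For \<open>\<rho>(A) < r < c\<close> the powers of \<open>A / r\<close> are bounded, although they multiply \<open>y\<close> by at least
  \<open>c / r > 1\<close> each time.
\<close>

lemma le_spectral_radius_of_subeigenvector:
  fixes A :: "real mat" and y :: "real vec"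
  assumes A: "A \<in> carrier_mat n n" and y: "y \<in> carrier_vec n"
    and A_nonneg: "\<And>i j. i < n \<Longrightarrow> j < n \<Longrightarrow> A $$ (i, j) \<ge> 0"
    and i: "i < n" "y $ i > 0"
    and sub: "\<And>i. i < n \<Longrightarrow> c * y $ i \<le> (A *\<^sub>v y) $ i"
  shows "c \<le> spectral_radius (map_mat complex_of_real A)"
proof (rule ccontr)
  let ?AC = "map_mat complex_of_real A"
  define s where "s = spectral_radius ?AC"
  assume "\<not> c \<le> spectral_radius ?AC"
  then have sc: "s < c" by (simp add: s_def)
  have n: "n > 0" using i by simp
  have AC: "?AC \<in> carrier_mat n n" using A by simp
  have s_max: "norm a \<le> s" if "a \<in> spectrum ?AC" for a
    unfolding s_def using spectral_radius_mem_max(2)[OF AC n] that by blast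
  have "s \<in> norm ` spectrum ?AC"
    unfolding s_def by (rule spectral_radius_mem_max(1)[OF AC n])
  then have s0: "s \<ge> 0" by auto
  \<comment> \<open>The midpoint lies strictly between \<open>s\<close> and \<open>c\<close>, and it
    is positive even when \<open>s = 0\<close>, so dividing by \<open>r\<close> is safe.\<close>
  define r where "r = (s + c) / 2"
  have r: "s < r" "r < c" "r > 0" using sc s0 by (auto simp: r_def)
  define M where "M = (1 / r) \<cdot>\<^sub>m A"
  let ?MC = "map_mat complex_of_real M"
  have M: "M \<in> carrier_mat n n" and MC: "?MC \<in> carrier_mat n n"
    using A by (simp_all add: M_def)
  have MC_eq: "?MC = complex_of_real (1 / r) \<cdot>\<^sub>m ?AC"
    unfolding M_def by (rule eq_matI) auto
  \<comment> \<open>An eigenvalue \<open>a\<close> of \<open>A / r\<close> gives the eigenvalue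
    \<open>a * r\<close> of \<open>A\<close> with the same eigenvector, hence
    \<open>norm a * r \<le> s < r\<close>.\<close>
  have "norm a < 1" if a: "a \<in> spectrum ?MC" for a
  proof -
    obtain v where v: "v \<in> carrier_vec n" "v \<noteq> 0\<^sub>v n" "?MC *\<^sub>v v = a \<cdot>\<^sub>v v"
      using a A M by (auto simp: spectrum_def eigenvalue_def eigenvector_def)
    have "?AC *\<^sub>v v = (a * of_real r) \<cdot>\<^sub>v v"
    proof (rule eq_vecI)
      fix k assume "k < dim_vec ((a * of_real r) \<cdot>\<^sub>v v)"
      then have k: "k < n" using v by simp
      have "complex_of_real (1 / r) * (?AC *\<^sub>v v) $ k = (?MC *\<^sub>v v) $ k"
        using k A v(1) unfolding MC_eq
          by (simp add: scalar_prod_def sum_distrib_left mult.assoc sum_divide_distrib)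
      also have "\<dots> = a * v $ k" using v k by simp
      finally show "(?AC *\<^sub>v v) $ k = ((a * of_real r) \<cdot>\<^sub>v v) $ k"
        using k v(1) r by (simp add: field_simps)
    qed (use A v in simp)
    then have "a * of_real r \<in> spectrum ?AC"
      using v A by (auto simp: spectrum_def eigenvalue_def eigenvector_def)
    from s_max[OF this] have "norm a * r \<le> s" using r by (simp add: norm_mult)
    with r have "norm a * r < 1 * r" by linarith
    then show ?thesis using r(3) mult_less_cancel_right_pos by blast
  qed
  then have "spectral_radius ?MC < 1"
    using spectral_radius_mem_max(1)[OF MC n] by auto
  \<comment> \<open>Spectral radius below 1 yields a single entrywise bound \<open>b\<close> valid
    for all powers.\<close>
  from spectral_radius_jnf_norm_bound_less_1_upper_triangular[OF MC this]
  obtain b where b: "norm_bound (?MC ^\<^sub>m k) b" for k by blast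
  have MC_pow: "?MC ^\<^sub>m k = map_mat complex_of_real (M ^\<^sub>m k)" for k
    by (rule of_real_hom.mat_hom_pow[OF M, symmetric])
  have Mb: "\<bar>(M ^\<^sub>m k) $$ (l, j)\<bar> \<le> b" if "l < n" "j < n" for k l j
    using b[of k] that M carrier_matD[OF pow_carrier_mat[OF M, of k]]
    unfolding norm_bound_def MC_pow by simp
  have M_nonneg: "(M ^\<^sub>m k) $$ (l, j) \<ge> 0" if "l < n" "j < n" for k l j
    using that
  proof (induction k arbitrary: l j)
    case 0
    then show ?case using M by simp
  next
    case (Suc k)
    have "0 \<le> (\<Sum>m = 0..<n. (M ^\<^sub>m k) $$ (l, m) * M $$ (m, j))"
      using Suc A_nonneg A r by (intro sum_nonneg mult_nonneg_nonneg) (auto simp: M_def)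
    then show ?case
      using Suc.prems M by (simp add: scalar_prod_def)
  qed
  define q where "q = c / r"
  have q: "q > 1" using r by (simp add: q_def)
  have My: "q * y $ l \<le> (M *\<^sub>v y) $ l" if "l < n" for l
  proof -
    have "(M *\<^sub>v y) $ l = (A *\<^sub>v y) $ l / r"
      using that A y by (simp add: M_def scalar_prod_def sum_distrib_left sum_divide_distrib)
    then show ?thesis using sub[OF that] r by (simp add: q_def field_simps)
  qed
  \<comment> \<open>Since the entries of \<open>M ^\<^sub>m k\<close> are nonnegative, applying this
    power to \<open>q * y \<le> M y\<close> keeps the inequality; the step splits off the last
    factor \<open>M\<close>.\<close>
  have grow: "q ^ k * y $ l \<le> (M ^\<^sub>m k *\<^sub>v y) $ l" if "l < n" for k l
    using that
  proof (induction k arbitrary: l)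
    case 0
    then show ?case using M y by simp
  next
    case (Suc k)
    have "q ^ Suc k * y $ l = q * (q ^ k * y $ l)" by simp
    also have "\<dots> \<le> q * (M ^\<^sub>m k *\<^sub>v y) $ l"
      using Suc q by (intro mult_left_mono) auto
    also have "\<dots> = (\<Sum>m = 0..<n. (M ^\<^sub>m k) $$ (l, m) * (q * y $ m))"
      using Suc.prems M y by (simp add: scalar_prod_def sum_distrib_left mult_ac)
    also have "\<dots> \<le> (\<Sum>m = 0..<n. (M ^\<^sub>m k) $$ (l, m) * (M *\<^sub>v y) $ m)"
      using My M_nonneg Suc.prems by (intro sum_mono mult_left_mono) auto
    also have "\<dots> = (M ^\<^sub>m k *\<^sub>v (M *\<^sub>v y)) $ l"
      using Suc.prems M y by (simp add: scalar_prod_def)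
    also have "\<dots> = (M ^\<^sub>m Suc k *\<^sub>v y) $ l"
      using assoc_mult_mat_vec[OF pow_carrier_mat[OF M] M y, of k] by simp
    finally show ?case .
  qed
  \<comment> \<open>A bound for row \<open>i\<close> of every
    \<open>M ^\<^sub>m k *\<^sub>v y\<close>. The moduli are there because \<open>y\<close> may have
    negative entries away from \<open>i\<close>.\<close>
  define K where "K = (\<Sum>m = 0..<n. b * \<bar>y $ m\<bar>)"
  have bounded: "q ^ k * y $ i \<le> K" for k
  proof -
    have "q ^ k * y $ i \<le> (M ^\<^sub>m k *\<^sub>v y) $ i" by (rule grow[OF i(1)])
    also have "\<dots> = (\<Sum>m = 0..<n. (M ^\<^sub>m k) $$ (i, m) * y $ m)"
      using i M y by (simp add: scalar_prod_def)
    also have "\<dots> \<le> K" unfolding K_def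
    proof (rule sum_mono)
      fix m assume m: "m \<in> {0..<n}"
      have "(M ^\<^sub>m k) $$ (i, m) * y $ m \<le> \<bar>(M ^\<^sub>m k) $$ (i, m)\<bar> * \<bar>y $ m\<bar>"
        by (metis abs_ge_self abs_mult)
      also have "\<dots> \<le> b * \<bar>y $ m\<bar>"
        using Mb i m by (intro mult_right_mono) auto
      finally show "(M ^\<^sub>m k) $$ (i, m) * y $ m \<le> b * \<bar>y $ m\<bar>" .
    qed
    finally show ?thesis .
  qed
  obtain k where "K / y $ i < q ^ k" using real_arch_pow[OF q] by blast
  with bounded[of k] i show False by (simp add: field_simps)
qed

section \<open>The adjacency operator on vertex functions\<close>

text \<open>The adjacency matrix acting on vertex functions, which frees the later arguments from
  labellings. The sum runs over the set of out-neighbours, in accordance with the 0/1 entries. The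
  value type is general so that real vectors and complex eigenvectors are both covered.\<close>

definition out_sum :: "('a, 'b) pre_digraph \<Rightarrow> ('a \<Rightarrow> 'c :: comm_monoid_add) \<Rightarrow> 'a \<Rightarrow> 'c" where
  "out_sum D x u = (\<Sum>v | u \<rightarrow>\<^bsub>D\<^esub> v. x v)"

lemma (in fin_digraph) finite_out_neighbours: "finite {v. u \<rightarrow>\<^bsub>G\<^esub> v}"
  by (rule finite_subset[OF _ finite_verts]) (auto dest: adj_in_verts)

lemma (in fin_digraph) sum_labelling_eq_out_sum:
  fixes x :: "'a \<Rightarrow> 'c :: semiring_1"
  assumes f: "is_labelling G f"
  shows "(\<Sum>j = 0..<card (verts G). (if u \<rightarrow>\<^bsub>G\<^esub> f j then 1 else 0) * x (f j)) = out_sum G x u"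
proof -
  have "(\<Sum>j = 0..<card (verts G). (if u \<rightarrow>\<^bsub>G\<^esub> f j then 1 else 0) * x (f j)) =
      (\<Sum>v\<in>verts G. (if u \<rightarrow>\<^bsub>G\<^esub> v then 1 else 0) * x v)"
    using f unfolding is_labelling_def by (rule sum.reindex_bij_betw)
  also have "\<dots> = (\<Sum>v\<in>verts G. if u \<rightarrow>\<^bsub>G\<^esub> v then x v else 0)"
    by (rule sum.cong) auto
  also have "\<dots> = (\<Sum>v | v \<in> verts G \<and> u \<rightarrow>\<^bsub>G\<^esub> v. x v)"
    by (simp add: sum.If_cases Int_def)
  also have "{v. v \<in> verts G \<and> u \<rightarrow>\<^bsub>G\<^esub> v} = {v. u \<rightarrow>\<^bsub>G\<^esub> v}"
    by (auto dest: adj_in_verts)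
  finally show ?thesis by (simp add: out_sum_def)
qed

lemma (in fin_digraph) adj_mat_mult_vec:
  fixes x :: "'a \<Rightarrow> real"
  assumes f: "is_labelling G f"
  shows "labelled_adj_mat G f *\<^sub>v vec (card (verts G)) (\<lambda>i. x (f i)) =
    vec (card (verts G)) (\<lambda>i. out_sum G x (f i))"
  by (rule eq_vecI)
    (simp_all add: labelled_adj_mat_def scalar_prod_def sum_labelling_eq_out_sum[OF f, symmetric])

lemma (in fin_digraph) complex_adj_mat_mult_vec:
  fixes x :: "'a \<Rightarrow> complex"
  assumes f: "is_labelling G f"
  shows "map_mat complex_of_real (labelled_adj_mat G f) *\<^sub>v vec (card (verts G)) (\<lambda>i. x (f i)) =
    vec (card (verts G)) (\<lambda>i. out_sum G x (f i))"
  by (rule eq_vecI)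
    (simp_all add: labelled_adj_mat_def scalar_prod_def sum_labelling_eq_out_sum[OF f, symmetric]
      if_distrib[of complex_of_real] cong: if_cong)

text \<open>Reading a vector through the inverse of the labelling gives a vertex function, so
  existence statements about vectors transfer to vertex functions.\<close>

lemma vec_eq_labelling:
  assumes f: "is_labelling D f" and v: "v \<in> carrier_vec (card (verts D))"
  obtains x where "v = vec (card (verts D)) (\<lambda>i. x (f i))"
proof
  let ?I = "{0..<card (verts D)}"
  show "v = vec (card (verts D)) (\<lambda>i. v $ inv_into ?I f (f i))"
    using f v by (intro eq_vecI) (auto simp: is_labelling_def bij_betw_inv_into_left)
qed

lemma labelling_ball:
  assumes "is_labelling D f"
  shows "(\<forall>i < card (verts D). P (f i)) \<longleftrightarrow> (\<forall>u \<in> verts D. P u)"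
proof -
  have image: "f ` {0..<card (verts D)} = verts D"
    using assms unfolding is_labelling_def by (rule bij_betw_imp_surj_on)
  have "(\<forall>i < card (verts D). P (f i)) \<longleftrightarrow> (\<forall>u \<in> f ` {0..<card (verts D)}. P u)"
    by auto
  then show ?thesis unfolding image .
qed

lemma labelling_vec_nonzero:
  assumes "is_labelling D f"
  shows "vec (card (verts D)) (\<lambda>i. x (f i)) \<noteq> 0\<^sub>v (card (verts D)) \<longleftrightarrow>
    (\<exists>u \<in> verts D. x u \<noteq> 0)"
proof -
  have "vec (card (verts D)) (\<lambda>i. x (f i)) = 0\<^sub>v (card (verts D)) \<longleftrightarrow>
      (\<forall>i < card (verts D). x (f i) = 0)"
    by (auto simp: vec_eq_iff)
  then show ?thesis using labelling_ball[OF assms, of "\<lambda>u. x u = 0"] by simp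
qed

text \<open>The scalar product is a sum of nonnegative terms, so it vanishes only if each term does:
  complementary slackness holds vertex by vertex.\<close>

lemma (in fin_digraph) complementarity_spectrum_iff:
  "l \<in> digraph_complementarity_spectrum G \<longleftrightarrow>
    (\<exists>x. (\<exists>u \<in> verts G. x u \<noteq> 0) \<and>
      (\<forall>u \<in> verts G. x u \<ge> 0 \<and> out_sum G x u \<ge> l * x u \<and> x u * (out_sum G x u - l * x u) = 0))"
    (is "_ \<longleftrightarrow> (\<exists>x. ?P x)")
proof -
  let ?n = "card (verts G)"
  obtain f where f: "is_labelling G f" using ex_labelling[OF finite_verts] by blast
  let ?A = "labelled_adj_mat G f"
  define Q where "Q = (\<lambda>x. x \<noteq> 0\<^sub>v ?n \<and> x \<ge> 0\<^sub>v ?n \<and> ?A *\<^sub>v x \<ge> l \<cdot>\<^sub>v x \<and>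
    scalar_prod x (?A *\<^sub>v x - l \<cdot>\<^sub>v x) = 0)"
  have dim: "dim_row ?A = ?n" by (simp add: labelled_adj_mat_def)
  have spec: "l \<in> digraph_complementarity_spectrum G \<longleftrightarrow> (\<exists>x \<in> carrier_vec ?n. Q x)"
    unfolding digraph_complementarity_spectrum_labelling[OF f] complementarity_spectrum_def Q_def
      dim mem_Collect_eq ..
  have QP: "Q (vec ?n (\<lambda>i. x (f i))) \<longleftrightarrow> ?P x" for x
  proof -
    let ?v = "vec ?n (\<lambda>i. x (f i))"
    have 1: "?v \<ge> 0\<^sub>v ?n \<longleftrightarrow> (\<forall>u \<in> verts G. x u \<ge> 0)"
      unfolding labelling_ball[OF f, symmetric] by (auto simp: less_eq_vec_def)
    have 2: "?A *\<^sub>v ?v \<ge> l \<cdot>\<^sub>v ?v \<longleftrightarrow> (\<forall>u \<in> verts G. out_sum G x u \<ge> l * x u)"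
      unfolding labelling_ball[OF f, symmetric] adj_mat_mult_vec[OF f]
      by (auto simp: less_eq_vec_def)
    have "scalar_prod ?v (?A *\<^sub>v ?v - l \<cdot>\<^sub>v ?v) =
        (\<Sum>i = 0..<?n. x (f i) * (out_sum G x (f i) - l * x (f i)))"
      unfolding adj_mat_mult_vec[OF f] by (simp add: scalar_prod_def)
    also have "\<dots> = (\<Sum>u \<in> verts G. x u * (out_sum G x u - l * x u))"
      using f unfolding is_labelling_def by (rule sum.reindex_bij_betw)
    finally have 3: "scalar_prod ?v (?A *\<^sub>v ?v - l \<cdot>\<^sub>v ?v) = 
        (\<Sum>u \<in> verts G. x u * (out_sum G x u - l * x u))" .
    have 4: "(\<Sum>u \<in> verts G. x u * (out_sum G x u - l * x u)) = 0 \<longleftrightarrow>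
        (\<forall>u \<in> verts G. x u * (out_sum G x u - l * x u) = 0)"
      if "\<forall>u \<in> verts G. x u \<ge> 0" "\<forall>u \<in> verts G. out_sum G x u \<ge> l * x u"
      using that by (intro sum_nonneg_eq_0_iff) auto
    show ?thesis
      unfolding Q_def labelling_vec_nonzero[OF f] 1 2 3 using 4 by blast
  qed
  show ?thesis unfolding spec
  proof
    assume "\<exists>v \<in> carrier_vec ?n. Q v"
    then obtain v where v: "v \<in> carrier_vec ?n" "Q v" by blast
    obtain x where x: "v = vec ?n (\<lambda>i. x (f i))" using vec_eq_labelling[OF f v(1)] .
    have "?P x" using v(2) unfolding x QP .
    then show "\<exists>x. ?P x" by (rule exI[of _ x])
  next
    assume "\<exists>x. ?P x"
    then obtain x where "?P x" ..
    then have "Q (vec ?n (\<lambda>i. x (f i)))" unfolding QP .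
    then show "\<exists>v \<in> carrier_vec ?n. Q v" using vec_carrier by (rule bexI)
  qed
qed

text \<open>The complex spectrum of a nonempty square matrix is finite and nonempty, so the maximal
  modulus is attained. At this stage \<open>\<mu>\<close> may still be non-real.\<close>

lemma (in fin_digraph) spectral_radius_eigenvector:
  assumes "verts G \<noteq> {}"
  obtains \<mu> :: complex and x where "norm \<mu> = digraph_spectral_radius G"
    "\<exists>u \<in> verts G. x u \<noteq> 0" "\<And>u. u \<in> verts G \<Longrightarrow> out_sum G x u = \<mu> * x u"
proof -
  let ?n = "card (verts G)"
  obtain f where f: "is_labelling G f" using ex_labelling[OF finite_verts] by blast
  let ?A = "map_mat complex_of_real (labelled_adj_mat G f)"
  have A: "?A \<in> carrier_mat ?n ?n" by (simp add: labelled_adj_mat_def)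
  have n: "?n > 0" using assms finite_verts by (simp add: card_gt_0_iff)
  obtain \<mu> where \<mu>: "\<mu> \<in> spectrum ?A" "norm \<mu> = digraph_spectral_radius G"
    using spectral_radius_mem_max(1)[OF A n] digraph_spectral_radius_labelling[OF f] by auto
  obtain v where v: "v \<in> carrier_vec ?n" "v \<noteq> 0\<^sub>v ?n" "?A *\<^sub>v v = \<mu> \<cdot>\<^sub>v v"
    using \<mu> A by (auto simp: spectrum_def eigenvalue_def eigenvector_def)
  obtain x where x: "v = vec ?n (\<lambda>i. x (f i))" using vec_eq_labelling[OF f v(1)] .
  have "\<forall>i < ?n. out_sum G x (f i) = \<mu> * x (f i)"
    using v(3) unfolding x complex_adj_mat_mult_vec[OF f] by (auto simp: vec_eq_iff)
  then have "\<forall>u \<in> verts G. out_sum G x u = \<mu> * x u"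
    unfolding labelling_ball[OF f, symmetric] .
  moreover have "\<exists>u \<in> verts G. x u \<noteq> 0"
    using v(2) unfolding x labelling_vec_nonzero[OF f] .
  ultimately show ?thesis using \<mu>(2) that by blast
qed

lemma (in fin_digraph) le_spectral_radius:
  fixes y :: "'a \<Rightarrow> real"
  assumes "u \<in> verts G" "y u > 0" and sub: "\<And>u. u \<in> verts G \<Longrightarrow> c * y u \<le> out_sum G y u"
  shows "c \<le> digraph_spectral_radius G"
proof -
  let ?n = "card (verts G)"
  obtain f where f: "is_labelling G f" using ex_labelling[OF finite_verts] by blast
  have "u \<in> f ` {0..<?n}"
    using f assms(1) unfolding is_labelling_def bij_betw_def by (elim conjE) (simp only:)
  then obtain i where i: "i < ?n" "f i = u" by auto
  have "\<forall>u \<in> verts G. c * y u \<le> out_sum G y u"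
    using sub by blast
  then have "\<forall>i < ?n. c * y (f i) \<le> out_sum G y (f i)"
    unfolding labelling_ball[OF f, symmetric] .
  then have "c * vec ?n (\<lambda>i. y (f i)) $ j \<le>
      (labelled_adj_mat G f *\<^sub>v vec ?n (\<lambda>i. y (f i))) $ j" if "j < ?n" for j
    unfolding adj_mat_mult_vec[OF f] using that by simp
  moreover have "vec ?n (\<lambda>i. y (f i)) $ i > 0" using i assms(2) by simp
  moreover have "labelled_adj_mat G f $$ (j, k) \<ge> 0" if "j < ?n" "k < ?n" for j k
    using that by (simp add: labelled_adj_mat_def)
  ultimately show ?thesis unfolding digraph_spectral_radius_labelling[OF f]
    using le_spectral_radius_of_subeigenvector[OF labelled_adj_mat_carrier vec_carrier _ i(1)]
    by blast
qed

section \<open>Perron vectors of strongly connected digraphs\<close>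

lemma (in fin_digraph) out_sum_mono:
  fixes x :: "'a \<Rightarrow> real"
  assumes "\<And>v. v \<in> verts G \<Longrightarrow> x v \<le> y v"
  shows "out_sum G x u \<le> out_sum G y u"
  unfolding out_sum_def using assms by (auto intro: sum_mono dest: adj_in_verts)

lemma (in fin_digraph) norm_out_sum_le:
  fixes x :: "'a \<Rightarrow> complex"
  shows "norm (out_sum G x u) \<le> out_sum G (\<lambda>v. norm (x v)) u"
  unfolding out_sum_def by (rule norm_sum)

text \<open>The function \<open>x\<close> is itself a subeigenvector, which bounds \<open>l\<close>
  from above. For the other bound, a complex eigenvector of maximal modulus is dominated by a
  multiple of \<open>x\<close> that touches it at some vertex, and the two eigenvalue equations are
  compared there.\<close>

lemma (in fin_digraph) spectral_radius_eqI:
  fixes x :: "'a \<Rightarrow> real"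
  assumes ne: "verts G \<noteq> {}" and pos: "\<And>u. u \<in> verts G \<Longrightarrow> x u > 0"
    and eig: "\<And>u. u \<in> verts G \<Longrightarrow> out_sum G x u = l * x u"
  shows "digraph_spectral_radius G = l"
proof (rule antisym)
  show "l \<le> digraph_spectral_radius G"
  proof -
    obtain u where "u \<in> verts G" using ne by blast
    then show ?thesis using pos eig by (intro le_spectral_radius[of u x]) simp_all
  qed
next
  obtain \<mu> :: complex and v where \<mu>: "norm \<mu> = digraph_spectral_radius G"
    and v: "\<exists>u \<in> verts G. v u \<noteq> 0" "\<And>u. u \<in> verts G \<Longrightarrow> out_sum G v u = \<mu> * v u"
    using spectral_radius_eigenvector[OF ne] by blast
  \<comment> \<open>The least factor for which \<open>c * x\<close> dominates the modulus of
    \<open>v\<close>; at the maximising vertex \<open>u\<close> the bound is an equality.\<close>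
  define c where "c = Max ((\<lambda>u. norm (v u) / x u) ` verts G)"
  have "c \<in> (\<lambda>u. norm (v u) / x u) ` verts G"
    unfolding c_def using ne finite_verts by (intro Max_in) auto
  then obtain u where u: "u \<in> verts G" "c = norm (v u) / x u" by blast
  have le: "norm (v w) \<le> c * x w" if "w \<in> verts G" for w
  proof -
    have "norm (v w) / x w \<le> c" unfolding c_def using that finite_verts by (intro Max_ge) auto
    then show ?thesis using pos[OF that] by (simp add: field_simps)
  qed
  \<comment> \<open>Positivity of \<open>c\<close> comes from \<open>v\<close> being nonzero; it
    allows \<open>c * x u\<close> to be cancelled at the end.\<close>
  have "c > 0"
  proof -
    obtain w where w: "w \<in> verts G" "v w \<noteq> 0" using v(1) by blast
    then have "0 < c * x w" using le[of w] by (smt (verit) zero_less_norm_iff)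
    then show ?thesis using pos[OF w(1)] by (simp add: zero_less_mult_iff)
  qed
  have "norm \<mu> * (c * x u) = norm (out_sum G v u)"
    using u v(2) pos[OF u(1)] by (simp add: norm_mult)
  also have "\<dots> \<le> out_sum G (\<lambda>w. norm (v w)) u" by (rule norm_out_sum_le)
  also have "\<dots> \<le> out_sum G (\<lambda>w. c * x w) u" by (rule out_sum_mono) (rule le)
  also have "\<dots> = l * (c * x u)"
    using eig[OF u(1)] by (simp add: out_sum_def sum_distrib_left[symmetric])
  finally show "digraph_spectral_radius G \<le> l"
    using \<mu> \<open>c > 0\<close> pos[OF u(1)] by (simp add: mult_le_cancel_right)
qed


section \<open>Iterating \<open>I + A\<close> on nonnegative vertex functions\<close>

lemma out_sum_add:
  "out_sum D (\<lambda>v. x v + y v) u = out_sum D x u + out_sum D y u"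
  by (simp add: out_sum_def sum.distrib)

lemma out_sum_diff_scale:
  fixes x y :: "'a \<Rightarrow> real"
  shows "out_sum D (\<lambda>v. x v - c * y v) u = out_sum D x u - c * out_sum D y u"
  by (simp add: out_sum_def sum_subtractf sum_distrib_left)

lemma (in fin_digraph) out_sum_nonneg:
  fixes x :: "'a \<Rightarrow> real"
  assumes "\<And>v. v \<in> verts G \<Longrightarrow> x v \<ge> 0"
  shows "out_sum G x u \<ge> 0"
  unfolding out_sum_def using assms by (auto intro!: sum_nonneg dest: adj_in_verts)

lemma (in fin_digraph) out_sum_ge_summand:
  fixes x :: "'a \<Rightarrow> real"
  assumes "\<And>v. v \<in> verts G \<Longrightarrow> x v \<ge> 0" and "u \<rightarrow>\<^bsub>G\<^esub> w"
  shows "x w \<le> out_sum G x u"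
  unfolding out_sum_def using assms finite_out_neighbours
  by (intro member_le_sum) (auto dest: adj_in_verts)

text \<open>The operator \<open>I + A\<close>. Thanks to the identity summand, iterates of a
  nonnegative function never decrease, so a vertex that has become positive stays positive.\<close>

definition lazy_step :: "('a, 'b) pre_digraph \<Rightarrow> ('a \<Rightarrow> real) \<Rightarrow> 'a \<Rightarrow> real" where
  "lazy_step D x u = x u + out_sum D x u"

lemma lazy_step_Suc:
  "(lazy_step D ^^ Suc k) x u = (lazy_step D ^^ k) x u + out_sum D ((lazy_step D ^^ k) x) u"
  unfolding funpow.simps comp_apply by (rule lazy_step_def)

text \<open>The iterates commute with the operator, so they act on the residual \<open>A x - c x\<close> of \<open>x\<close>.\<close>

lemma lazy_step_residual:
  "(lazy_step D ^^ k) (\<lambda>u. out_sum D x u - c * x u) =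
    (\<lambda>u. out_sum D ((lazy_step D ^^ k) x) u - c * (lazy_step D ^^ k) x u)"
proof (induction k)
  case (Suc k)
  show ?case
    by (simp add: Suc.IH, rule ext)
      (simp add: lazy_step_def[abs_def] out_sum_add out_sum_diff_scale algebra_simps)
qed simp

lemma (in fin_digraph) lazy_step_ge:
  assumes "\<And>v. v \<in> verts G \<Longrightarrow> x v \<ge> 0" and "v \<in> verts G"
  shows "x v \<le> (lazy_step G ^^ k) x v"
  using assms(2)
proof (induction k arbitrary: v)
  case (Suc k)
  have "0 \<le> out_sum G ((lazy_step G ^^ k) x) v"
    using Suc.IH assms(1) by (intro out_sum_nonneg) (meson order_trans)
  then show ?case using Suc.IH[OF Suc.prems] unfolding lazy_step_Suc by linarith
qed simp

lemma (in fin_digraph) lazy_step_mono: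
  assumes nn: "\<And>v. v \<in> verts G \<Longrightarrow> x v \<ge> 0" and v: "v \<in> verts G" and "k \<le> m"
  shows "(lazy_step G ^^ k) x v \<le> (lazy_step G ^^ m) x v"
proof -
  have "(lazy_step G ^^ k) x w \<ge> 0" if "w \<in> verts G" for w
    using lazy_step_ge[of x, OF nn that] nn[OF that] by (meson order_trans)
  from lazy_step_ge[of "(lazy_step G ^^ k) x", OF this v, where k = "m - k"]
  have "(lazy_step G ^^ k) x v \<le> (lazy_step G ^^ (m - k)) ((lazy_step G ^^ k) x) v" .
  also have "\<dots> = (lazy_step G ^^ (m - k + k)) x v"
    unfolding funpow_add comp_apply ..
  finally show ?thesis using \<open>k \<le> m\<close> by simp
qed

text \<open>Each step passes positivity from the head of an arc to its tail. By induction along a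
  walk to \<open>w\<close>, every vertex becomes positive after some number of steps.\<close>

lemma (in fin_digraph) lazy_step_pos:
  assumes sc: "strongly_connected G" and nn: "\<And>v. v \<in> verts G \<Longrightarrow> x v \<ge> 0"
    and w: "w \<in> verts G" "x w > 0"
  obtains m where "\<And>u. u \<in> verts G \<Longrightarrow> (lazy_step G ^^ m) x u > 0"
proof -
  have "\<exists>k. (lazy_step G ^^ k) x u > 0" if "u \<in> verts G" for u
  proof -
    have "u \<rightarrow>\<^sup>*\<^bsub>G\<^esub> w" using sc that w(1) unfolding strongly_connected_def by simp
    then show ?thesis
    proof (induction rule: converse_reachable_induct)
      case base
      show ?case using w(2) by (intro exI[of _ 0]) simp
    next
      case (step u v)
      then obtain k where k: "(lazy_step G ^^ k) x v > 0" by blast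
      have nnk: "(lazy_step G ^^ k) x z \<ge> 0" if "z \<in> verts G" for z
        using lazy_step_ge[of x, OF nn that] nn[OF that] by (meson order_trans)
      have "(lazy_step G ^^ k) x v \<le> out_sum G ((lazy_step G ^^ k) x) u"
        using step nnk by (intro out_sum_ge_summand)
      then have "(lazy_step G ^^ Suc k) x u > 0"
        using k nnk[OF adj_in_verts(1)[OF step(1)]] unfolding lazy_step_Suc by linarith
      then show ?case ..
    qed
  qed
  then obtain k where k: "\<And>u. u \<in> verts G \<Longrightarrow> (lazy_step G ^^ k u) x u > 0" by metis
  \<comment> \<open>The exponents found so far depend on the vertex; by monotonicity the largest of
    them serves all vertices.\<close>
  have "(lazy_step G ^^ Max (k ` verts G)) x u > 0" if "u \<in> verts G" for u
    using k[OF that] lazy_step_mono[of x u "k u" "Max (k ` verts G)"] nn that finite_verts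
    by (meson Max_ge finite_imageI imageI order_less_le_trans)
  then show ?thesis by (rule that)
qed

text \<open>By \<open>le_spectral_radius\<close>, the factor \<open>?r\<close> in
  \<open>?r * x \<le> A x\<close> cannot be raised for any function that is positive somewhere.
  Strictness at a single vertex would allow it to be raised after smoothing with
  \<open>I + A\<close>.\<close>

lemma (in fin_digraph) strongly_connected_perron_vector:
  assumes sc: "strongly_connected G"
  obtains x :: "'a \<Rightarrow> real" where "\<exists>u \<in> verts G. x u \<noteq> 0" "\<And>u. u \<in> verts G \<Longrightarrow> x u \<ge> 0"
    "\<And>u. u \<in> verts G \<Longrightarrow> out_sum G x u = digraph_spectral_radius G * x u"
proof -
  let ?r = "digraph_spectral_radius G"
  have ne: "verts G \<noteq> {}" using sc unfolding strongly_connected_def by (rule conjunct1)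
  obtain \<mu> :: complex and v where \<mu>: "norm \<mu> = ?r" and v: "\<exists>u \<in> verts G. v u \<noteq> 0"
    "\<And>u. u \<in> verts G \<Longrightarrow> out_sum G v u = \<mu> * v u"
    using spectral_radius_eigenvector[OF ne] by blast
  define x where "x = (\<lambda>u. norm (v u))"
  \<comment> \<open>The triangle inequality applied to the eigenvalue equation of
    \<open>v\<close>.\<close>
  have sub: "?r * x u \<le> out_sum G x u" if "u \<in> verts G" for u
    using norm_out_sum_le[of v u] v(2)[OF that] \<mu> by (simp add: x_def norm_mult)
  have "out_sum G x u = ?r * x u" if u: "u \<in> verts G" for u
  proof (rule ccontr)
    assume "out_sum G x u \<noteq> ?r * x u"
    define w where "w = (\<lambda>u. out_sum G x u - ?r * x u)"
    have "w u > 0" using sub[OF u] \<open>out_sum G x u \<noteq> ?r * x u\<close> by (simp add: w_def)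
    moreover have "w z \<ge> 0" if "z \<in> verts G" for z using sub[OF that] by (simp add: w_def)
    ultimately obtain m where m: "\<And>z. z \<in> verts G \<Longrightarrow> (lazy_step G ^^ m) w z > 0"
      using lazy_step_pos[OF sc _ u] by blast
    define y where "y = (lazy_step G ^^ m) x"
    \<comment> \<open>The residual of \<open>y\<close> is the \<open>m\<close>-th iterate of the
      residual \<open>w\<close> of \<open>x\<close>, hence positive at every vertex.\<close>
    have gap: "out_sum G y z - ?r * y z > 0" if "z \<in> verts G" for z
      using m[OF that] unfolding w_def lazy_step_residual y_def .
    have xy: "x z \<le> y z" if "z \<in> verts G" for z
      unfolding y_def using that by (intro lazy_step_ge) (simp_all add: x_def)
    have y0: "0 \<le> y z" if "z \<in> verts G" for z
      using xy[OF that] by (auto simp: x_def intro: order_trans[OF norm_ge_zero])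
    \<comment> \<open>The denominator \<open>1 + y z\<close> avoids division by zero, as
      \<open>y z\<close> is only known to be nonnegative; \<open>e * (1 + y z)\<close> still bounds
      \<open>e * y z\<close> from above.\<close>
    define e where "e = Min ((\<lambda>z. (out_sum G y z - ?r * y z) / (1 + y z)) ` verts G)"
    have "e \<in> (\<lambda>z. (out_sum G y z - ?r * y z) / (1 + y z)) ` verts G"
      unfolding e_def using ne finite_verts by (intro Min_in) auto
    then have e0: "e > 0" using gap y0 by (auto intro!: divide_pos_pos add_pos_nonneg)
    have "(?r + e) * y z \<le> out_sum G y z" if z: "z \<in> verts G" for z
    proof -
      have "e \<le> (out_sum G y z - ?r * y z) / (1 + y z)"
        unfolding e_def using z finite_verts by (intro Min_le) auto
      then have "e * (1 + y z) \<le> out_sum G y z - ?r * y z"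
        using y0[OF z] by (simp add: pos_le_divide_eq)
      then show ?thesis using e0 by (simp add: algebra_simps)
    qed
    moreover obtain z where z: "z \<in> verts G" "v z \<noteq> 0" using v(1) by blast
    moreover have "y z > 0" using xy[OF z(1)] z(2)
      by (auto simp: x_def intro: less_le_trans[of _ "norm (v z)"])
    ultimately have "?r + e \<le> ?r" by (intro le_spectral_radius)
    then show False using e0 by simp
  qed
  moreover have "\<exists>u \<in> verts G. x u \<noteq> 0" using v(1) by (simp add: x_def)
  moreover have "x u \<ge> 0" for u by (simp add: x_def)
  ultimately show ?thesis using that by blast
qed

section \<open>Induced subgraphs\<close>

lemma induced_subgraph_dominates_iff:
  assumes "induced_subgraph H D" "u \<in> verts H" "v \<in> verts H"
  shows "u \<rightarrow>\<^bsub>H\<^esub> v \<longleftrightarrow> u \<rightarrow>\<^bsub>D\<^esub> v"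
proof -
  have "tail H = tail D" "head H = head D"
    using assms(1) by (auto simp: induced_subgraph_def subgraph_def compatible_def)
  moreover have "arcs H = {e \<in> arcs D. tail D e \<in> verts H \<and> head D e \<in> verts H}"
    using assms(1) by (simp add: induced_subgraph_def)
  ultimately show ?thesis using assms(2,3) by (auto simp: arcs_ends_conv)
qed

text \<open>Arcs from \<open>u\<close> that leave \<open>H\<close> contribute zero. This serves both
  to restrict an eigenvector to a sink of its support and to extend one by zero.\<close>

lemma (in fin_digraph) out_sum_induced:
  fixes x y :: "'a \<Rightarrow> real"
  assumes H: "induced_subgraph H G" and u: "u \<in> verts H"
    and eq: "\<And>v. v \<in> verts H \<Longrightarrow> x v = y v"
    and out: "\<And>v. u \<rightarrow>\<^bsub>G\<^esub> v \<Longrightarrow> v \<notin> verts H \<Longrightarrow> y v = 0"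
  shows "out_sum H x u = out_sum G y u"
  unfolding out_sum_def
proof (rule sum.mono_neutral_cong_left[OF finite_out_neighbours])
  interpret H: wf_digraph H using H by (rule wf_digraphI_induced)
  have dom: "v \<in> verts H" if "u \<rightarrow>\<^bsub>H\<^esub> v" for v using that by (rule H.adj_in_verts)
  show "{v. u \<rightarrow>\<^bsub>H\<^esub> v} \<subseteq> {v. u \<rightarrow>\<^bsub>G\<^esub> v}"
    using dom induced_subgraph_dominates_iff[OF H u] by blast
  show "\<forall>v \<in> {v. u \<rightarrow>\<^bsub>G\<^esub> v} - {v. u \<rightarrow>\<^bsub>H\<^esub> v}. y v = 0"
    using out induced_subgraph_dominates_iff[OF H u] by blast
  show "x v = y v" if "v \<in> {v. u \<rightarrow>\<^bsub>H\<^esub> v}" for v using that dom eq by blast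
qed

text \<open>\<open>C\<close> is a terminal strong component of the subdigraph induced on
  \<open>S\<close>.\<close>

lemma (in fin_digraph) ex_strongly_connected_sink:
  assumes S: "S \<subseteq> verts G" "S \<noteq> {}"
  obtains C where "C \<subseteq> S" "strongly_connected (G \<restriction> C)"
    "\<And>u v. u \<in> C \<Longrightarrow> v \<in> S \<Longrightarrow> u \<rightarrow>\<^bsub>G\<^esub> v \<Longrightarrow> v \<in> C"
proof -
  define closed where
    "closed C \<longleftrightarrow> C \<noteq> {} \<and> C \<subseteq> S \<and> (\<forall>u \<in> C. \<forall>v \<in> S. u \<rightarrow>\<^bsub>G\<^esub> v \<longrightarrow> v \<in> C)" for C
  \<comment> \<open>The vertices reachable inside a closed set from one of its points form a closed set again, so a
    closed set of least size is strongly connected.\<close>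
  have "closed S" using S by (simp add: closed_def)
  then obtain C where C: "closed C" and min: "\<And>C'. closed C' \<Longrightarrow> card C \<le> card C'"
    using ex_has_least_nat[of closed S card] by blast
  have CV: "C \<subseteq> verts G" using C S by (auto simp: closed_def)
  then have fin: "finite C" using finite_verts by (rule finite_subset)
  have ind: "induced_subgraph (G \<restriction> C) G" using CV by (rule induced_induce)
  interpret H: wf_digraph "G \<restriction> C" by (rule wellformed_induce_subgraph)
  have "v \<rightarrow>\<^sup>*\<^bsub>G \<restriction> C\<^esub> w" if v: "v \<in> C" and w: "w \<in> C" for v w
  proof -
    let ?R = "{w. v \<rightarrow>\<^sup>*\<^bsub>G \<restriction> C\<^esub> w}"
    have RC: "?R \<subseteq> C" using H.reachable_in_verts(2) by auto
    have "closed ?R" unfolding closed_def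
    proof (intro conjI ballI impI)
      have "v \<in> ?R" using v by (simp add: H.reachable_refl)
      then show "?R \<noteq> {}" by blast
      show "?R \<subseteq> S" using RC C by (auto simp: closed_def)
      fix a b assume a: "a \<in> ?R" and b: "b \<in> S" and ab: "a \<rightarrow>\<^bsub>G\<^esub> b"
      have "a \<in> C" "b \<in> C" using RC a b ab C by (auto simp: closed_def)
      then have "a \<rightarrow>\<^bsub>G \<restriction> C\<^esub> b" using ab induced_subgraph_dominates_iff[OF ind] by simp
      then show "b \<in> ?R" using a H.reachable_adj_trans by blast
    qed
    then have "?R = C" using min RC fin by (simp add: card_seteq)
    then show ?thesis using w by blast
  qed
  then have "strongly_connected (G \<restriction> C)"
    using C by (intro strongly_connectedI) (auto simp: closed_def)
  with C show ?thesis using that by (auto simp: closed_def)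
qed

section \<open>The two inclusions between complementarity eigenvalues and spectral radii\<close>

theorem theorem4p2:
  fixes D :: "('a, 'b) pre_digraph"
  assumes "digraph D"
  shows "digraph_complementarity_spectrum D =
    {digraph_spectral_radius H | H. induced_subgraph H D \<and> strongly_connected H}"
proof (intro subset_antisym subsetI)
  interpret D: digraph D by (rule assms)
  fix l assume "l \<in> digraph_complementarity_spectrum D"
  then obtain x where x_ne: "\<exists>u \<in> verts D. x u \<noteq> 0"
    and x: "\<And>u. u \<in> verts D \<Longrightarrow> x u \<ge> 0"
      "\<And>u. u \<in> verts D \<Longrightarrow> x u * (out_sum D x u - l * x u) = 0"
    unfolding D.complementarity_spectrum_iff by blast
  define S where "S = {u \<in> verts D. x u \<noteq> 0}"
  have S: "S \<subseteq> verts D" "S \<noteq> {}" using x_ne by (auto simp: S_def)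
  obtain C where C: "C \<subseteq> S" and sc: "strongly_connected (D \<restriction> C)"
    and sink: "\<And>u v. u \<in> C \<Longrightarrow> v \<in> S \<Longrightarrow> u \<rightarrow>\<^bsub>D\<^esub> v \<Longrightarrow> v \<in> C"
    using D.ex_strongly_connected_sink[OF S] by blast
  have CV: "C \<subseteq> verts D" using C S by blast
  then have ind: "induced_subgraph (D \<restriction> C) D" by (rule D.induced_induce)
  interpret H: digraph "D \<restriction> C" using ind by (rule D.digraphI_induced)
  have "digraph_spectral_radius (D \<restriction> C) = l"
  proof (rule H.spectral_radius_eqI)
    show "verts (D \<restriction> C) \<noteq> {}" using sc unfolding strongly_connected_def by (rule conjunct1)
    fix u assume "u \<in> verts (D \<restriction> C)"
    then have u: "u \<in> C" by simp
    then have uS: "u \<in> verts D" "x u \<noteq> 0" using C by (auto simp: S_def)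
    then show "x u > 0" using x(1) by (simp add: order_less_le)
    have "out_sum (D \<restriction> C) x u = out_sum D x u"
    proof (rule D.out_sum_induced[OF ind])
      \<comment> \<open>An arc from \<open>C\<close> to a vertex outside \<open>C\<close> must leave
        the support \<open>S\<close>, where \<open>x\<close> vanishes.\<close>
      show "x v = 0" if "u \<rightarrow>\<^bsub>D\<^esub> v" "v \<notin> verts (D \<restriction> C)" for v
        using sink[OF u, of v] that D.adj_in_verts(2) by (auto simp: S_def)
    qed (use u in simp_all)
    also have "\<dots> = l * x u" using x(2)[OF uS(1)] uS(2) by simp
    finally show "out_sum (D \<restriction> C) x u = l * x u" .
  qed
  with ind sc show "l \<in> {digraph_spectral_radius H | H. induced_subgraph H D \<and> strongly_connected H}"
    by blast
next
  interpret D: digraph D by (rule assms)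
  fix l assume "l \<in> {digraph_spectral_radius H | H. induced_subgraph H D \<and> strongly_connected H}"
  then obtain H where H: "induced_subgraph H D" "strongly_connected H"
    and l: "l = digraph_spectral_radius H" by blast
  interpret H: digraph H using H(1) by (rule D.digraphI_induced)
  have HD: "verts H \<subseteq> verts D" using H(1) by (auto simp: induced_subgraph_def subgraph_def)
  obtain x :: "'a \<Rightarrow> real" where x_ne: "\<exists>u \<in> verts H. x u \<noteq> 0"
    and x: "\<And>u. u \<in> verts H \<Longrightarrow> x u \<ge> 0" "\<And>u. u \<in> verts H \<Longrightarrow> out_sum H x u = l * x u"
    using H.strongly_connected_perron_vector[OF H(2)] l by blast
  define y where "y u = (if u \<in> verts H then x u else 0)" for u
  have on_H: "out_sum D y u = l * y u" if "u \<in> verts H" for u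
    using D.out_sum_induced[OF H(1) that, of x y] x(2)[OF that] that by (simp add: y_def)
  \<comment> \<open>Outside \<open>H\<close> the function \<open>y\<close> is zero, so slackness is
    trivial and the required inequality reduces to this one; on \<open>H\<close> the eigenvalue
    equation gives both.\<close>
  have "out_sum D y u \<ge> 0" for u using x(1) by (intro D.out_sum_nonneg) (simp add: y_def)
  then have "y u \<ge> 0 \<and> out_sum D y u \<ge> l * y u \<and> y u * (out_sum D y u - l * y u) = 0" for u
    using on_H[of u] x(1)[of u] by (cases "u \<in> verts H") (auto simp: y_def)
  moreover have "\<exists>u \<in> verts D. y u \<noteq> 0" using x_ne HD by (auto simp: y_def)
  ultimately show "l \<in> digraph_complementarity_spectrum D"
    unfolding D.complementarity_spectrum_iff by blast
qed

end
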